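(* Let $n,m\ge1$ be integers. Consider the inexact Uzawa Double Deep Ritz iteration in which the first Deep Ritz problem (the $r$-update) is approximated by $n$ gradient steps and the second (the $u$-update) by $m$ gradient steps: given initial $r^{-1}\in V$ and $u^0\in U$, for $k=0,1,2,\dots$, set $r^{k,0}=r^{k-1}$, $$r^{k,j+1}=r^{k,j}-\alpha\big(r^{k,j}-R_V^{-1}(\ell-Bu^k)\big),\quad j=0,\dots,n-1,\qquad r^k=r^{k,n},$$ and then set $u^{k,0}=u^k$, $$u^{k,j+1}=u^{k,j}-\omega\big(u^{k,j+1}-u^k-\tau R_U^{-1}B^*r^k\big),\quad j=0,\dots,m-1,\qquad u^{k+1}=u^{k,m}.$$ Let $(r^*,u^* )\in V\times U$ be the solution of the saddle-point problem $$(r^*,v)_V+b(u^*,v)=\ell(v)\quad\forall v\in V,\qquad b(w,r^* )=0\quad\forall w\in U.$$ Then for $0<\alpha<1$, $0<\omega<1$ and $0<\tau<\frac{2}{M^2}$, the errors satisfy $$e_r^k=r^k-r^*\longrightarrow0,\qquad e_u^k=u^k-u^*\longrightarrow0\qquad\text{as }k\to\infty.$$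
   Context: $U$ and $V$ are real Hilbert spaces with duals $U^*$, $V^*$. $b:U\times V\to\mathbb{R}$ is a bilinear form, $\ell\in V^*$ a continuous linear functional, and $B:U\to V^*$ is the operator defined by $\langle Bu,v\rangle_{V^*,V}=b(u,v)$. There are constants $0<m_B\le M$ with $m_B\|u\|_U\le\|Bu\|_{V^*}\le M\|u\|_U$ for all $u\in U$. $B^*:V\to U^*$ is the dual operator, $\langle B^*v,u\rangle_{U^*,U}=b(u,v)$. $R_U:U\to U^*$ and $R_V:V\to V^*$ are the Riesz maps, $\langle R_Uu,w\rangle_{U^*,U}=(u,w)_U$ and $\langle R_Vr,v\rangle_{V^*,V}=(r,v)_V$. The inner $u$-steps are implicit in $u^{k,j+1}$, as written. *)

theory Defs
  imports "HOL-Analysis.Analysis"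
begin

text \<open>A real Hilbert space is a type of sort \<open>{real_inner, complete_space}\<close>, and its dual is
  \<open>'a \<Rightarrow>\<^sub>L real\<close>, normed by the operator norm.

  The Riesz map is the library's \<open>blinfun_inner_right\<close>, which sends \<open>x\<close> to the functional
  \<open>y \<mapsto> x \<bullet> y\<close>. On a Hilbert space it is bijective by the Riesz representation theorem, so the
  HOL function inverse \<open>inv\<close> is its genuine two-sided inverse there.\<close>

abbreviation riesz_map :: "'a::{real_inner, complete_space} \<Rightarrow> ('a \<Rightarrow>\<^sub>L real)" where
  "riesz_map \<equiv> blinfun_inner_right"

abbreviation riesz_inv :: "('a::{real_inner, complete_space} \<Rightarrow>\<^sub>L real) \<Rightarrow> 'a" where
  "riesz_inv \<equiv> inv riesz_map"

text \<open>Iterates of the inexact Uzawa double Deep Ritz method. The double sequences \<open>ri k j\<close> and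
  \<open>ui k j\<close> are the inner iterates $r^{k,j}$ and $u^{k,j}$; they are constrained only for \<open>j \<le> n\<close>
  and \<open>j \<le> m\<close> respectively. The index $-1$ of the initial residual is avoided by passing
  \<open>r_init\<close> for $r^{-1}$. The \<open>u\<close>-step contains \<open>ui k (Suc j)\<close> on both sides: it is
  an implicit step.\<close>

definition uzawa_ddr_iterates ::
  "nat \<Rightarrow> nat \<Rightarrow> real \<Rightarrow> real \<Rightarrow> real
    \<Rightarrow> ('u::{real_inner, complete_space} \<Rightarrow> ('v::{real_inner, complete_space} \<Rightarrow>\<^sub>L real))
    \<Rightarrow> ('v \<Rightarrow> ('u \<Rightarrow>\<^sub>L real)) \<Rightarrow> ('v \<Rightarrow>\<^sub>L real) \<Rightarrow> 'v \<Rightarrow> 'u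
    \<Rightarrow> (nat \<Rightarrow> 'v) \<Rightarrow> (nat \<Rightarrow> nat \<Rightarrow> 'v) \<Rightarrow> (nat \<Rightarrow> 'u) \<Rightarrow> (nat \<Rightarrow> nat \<Rightarrow> 'u) \<Rightarrow> bool" where
  "uzawa_ddr_iterates n m \<alpha> \<omega> \<tau> B Bstar l r_init u_init r ri u ui \<longleftrightarrow>
     u 0 = u_init \<and>
     (\<forall>k. ri k 0 = (if k = 0 then r_init else r (k - 1)) \<and>
          (\<forall>j<n. ri k (Suc j) = ri k j - \<alpha> *\<^sub>R (ri k j - riesz_inv (l - B (u k)))) \<and>
          r k = ri k n \<and>
          ui k 0 = u k \<and>
          (\<forall>j<m. ui k (Suc j) =
             ui k j - \<omega> *\<^sub>R (ui k (Suc j) - u k - \<tau> *\<^sub>R riesz_inv (Bstar (r k)))) \<and>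
          u (Suc k) = ui k m)"

end

theory Submission
  imports Defs
begin

text \<open>Write \<open>T = R\<^sub>V\<inverse> B\<close> and let \<open>T\<^sup>* = R\<^sub>U\<inverse> B\<^sup>*\<close> be its adjoint. Each of the two inner
  loops relaxes towards a point that stays fixed during the loop: an explicit step multiplies the
  distance to it by \<open>1 - \<alpha>\<close>, an implicit one by \<open>1 / (1 + \<omega>)\<close>. With
  \<open>q = (1 - \<alpha>)\<^sup>n\<close> and the reduced step size \<open>\<theta> = (1 - (1 + \<omega>)\<^sup>-\<^sup>m) \<tau>\<close> a whole
  sweep therefore acts on the errors by
  \<open>e\<^sub>r\<^sup>k = q e\<^sub>r\<^sup>k\<^sup>-\<^sup>1 - (1 - q) T e\<^sub>u\<^sup>k\<close> and
  \<open>e\<^sub>u\<^sup>k\<^sup>+\<^sup>1 = e\<^sub>u\<^sup>k + \<theta> T\<^sup>* e\<^sub>r\<^sup>k\<close>.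

  Eliminating the residual error gives the heavy-ball recursion
  \<open>e\<^sub>u\<^sup>k\<^sup>+\<^sup>2 = (1 + q) e\<^sub>u\<^sup>k\<^sup>+\<^sup>1 - q e\<^sub>u\<^sup>k - A e\<^sub>u\<^sup>k\<^sup>+\<^sup>1\<close> with the
  self-adjoint operator \<open>A = (1 - q) \<theta> T\<^sup>* T\<close>. The bounds on \<open>B\<close> make \<open>A\<close> coercive and
  bounded by \<open>(1 - q) \<theta> M\<^sup>2 < 2 (1 - q)\<close>, which lies below the stability limit
  \<open>2 (1 + q)\<close>. An energy argument that never diagonalises \<open>A\<close> (\<open>heavy_ball_tendsto_0\<close>) then
  yields \<open>e\<^sub>u\<^sup>k \<longlonglongrightarrow> 0\<close>.

  The residual error need not be controlled by \<open>T\<^sup>* e\<^sub>r\<^sup>k\<close>, because \<open>T\<^sup>*\<close> may have a kernel.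
  But the first of the two relations says that it is contracted by \<open>q < 1\<close> up to the forcing
  \<open>T e\<^sub>u\<^sup>k \<longlonglongrightarrow> 0\<close>, hence it vanishes as well (\<open>forced_contraction_tendsto_0\<close>).\<close>

section \<open>The Riesz representation theorem\<close>

text \<open>The Riesz representative of \<open>f\<close> is the minimiser of \<open>\<parallel>x\<parallel>\<^sup>2 / 2 - f x\<close>. This energy is bounded
  below by \<open>-\<parallel>f\<parallel>\<^sup>2 / 2\<close>, the parallelogram law makes every minimising sequence Cauchy, and
  comparing the minimum with its values along a line gives the representation.\<close>

lemma riesz_representation:
  fixes f :: "'a::{real_inner, complete_space} \<Rightarrow>\<^sub>L real"
  obtains x where "\<And>h. x \<bullet> h = blinfun_apply f h"
proof -
  define J where "J x = (x \<bullet> x) / 2 - blinfun_apply f x" for x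
  have lower: "- (norm f)\<^sup>2 / 2 \<le> J x" for x
  proof -
    have "blinfun_apply f x \<le> norm f * norm x"
      using norm_blinfun[of f x] by simp
    moreover have "0 \<le> (norm x - norm f)\<^sup>2" by simp
    ultimately show ?thesis
      unfolding J_def by (simp add: power2_norm_eq_inner[symmetric] power2_diff)
        (simp add: algebra_simps)
  qed
  define \<mu> where "\<mu> = (INF x. J x)"
  have bdd: "bdd_below (range J)"
    using lower by (auto intro!: bdd_belowI)
  have \<mu>_le: "\<mu> \<le> J x" for x
    unfolding \<mu>_def by (rule cINF_lower[OF bdd]) simp
  have "\<exists>x. J x < \<mu> + inverse (real (Suc i))" for i
  proof -
    have "Inf (range J) < \<mu> + inverse (real (Suc i))"
      unfolding \<mu>_def by simp
    from cInf_lessD[OF _ this] show ?thesis by auto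
  qed
  then obtain X where X: "\<And>i. J (X i) < \<mu> + inverse (real (Suc i))"
    by metis
  have parallelogram: "(norm (x - y))\<^sup>2 / 4 = J x + J y - 2 * J ((1/2) *\<^sub>R (x + y))" for x y
    unfolding J_def power2_norm_eq_inner
    by (simp add: blinfun.add_right blinfun.scaleR_right inner_simps inner_commute[of y x])
       (simp add: field_simps)
  have gap: "(norm (X i - X j))\<^sup>2 < 4 * (inverse (real (Suc i)) + inverse (real (Suc j)))" for i j
    using parallelogram[of "X i" "X j"] X[of i] X[of j] \<mu>_le[of "(1/2) *\<^sub>R (X i + X j)"]
    by simp
  have "Cauchy X"
  proof (rule CauchyI)
    fix e :: real assume e: "0 < e"
    then obtain N where N: "inverse (real (Suc N)) < e\<^sup>2 / 8"
      using reals_Archimedean[of "e\<^sup>2 / 8"] by auto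
    have "norm (X i - X j) < e" if "i \<ge> N" "j \<ge> N" for i j
    proof -
      have "inverse (real (Suc i)) + inverse (real (Suc j))
          \<le> inverse (real (Suc N)) + inverse (real (Suc N))"
        using that by (intro add_mono le_imp_inverse_le) simp_all
      with N gap[of i j] have "(norm (X i - X j))\<^sup>2 < e\<^sup>2"
        by (simp del: of_nat_Suc)
      with e show ?thesis
        by (simp add: power_less_imp_less_base)
    qed
    then show "\<exists>N. \<forall>i\<ge>N. \<forall>j\<ge>N. norm (X i - X j) < e" by blast
  qed
  then obtain x where x: "X \<longlonglongrightarrow> x"
    using Cauchy_convergent convergent_def by blast
  have "(\<lambda>i. J (X i)) \<longlonglongrightarrow> J x"
    unfolding J_def by (intro tendsto_intros x) simp
  moreover have "(\<lambda>i. \<mu> + inverse (real (Suc i))) \<longlonglongrightarrow> \<mu>"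
    using tendsto_add[OF tendsto_const[of \<mu>] LIMSEQ_inverse_real_of_nat] by simp
  ultimately have "J x \<le> \<mu>"
    using X by (intro LIMSEQ_le) (auto intro: less_imp_le)
  with \<mu>_le have minimal: "J x \<le> J y" for y
    using order_trans by blast
  have "x \<bullet> h = blinfun_apply f h" for h
  proof (cases "h = 0")
    case False
    define D where "D = x \<bullet> h - blinfun_apply f h"
    have "J (x + t *\<^sub>R h) = J x + t * D + t\<^sup>2 * (h \<bullet> h) / 2" for t
      unfolding J_def D_def
      by (simp add: blinfun.add_right blinfun.scaleR_right inner_simps inner_commute[of h x])
         (simp add: field_simps power2_eq_square)
    \<comment> \<open>the minimum of this quadratic in \<open>t\<close>\<close>
    from this[of "- D / (h \<bullet> h)"] have "J (x + (- D / (h \<bullet> h)) *\<^sub>R h) = J x - D\<^sup>2 / (2 * (h \<bullet> h))"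
      using False by (simp add: field_simps power2_eq_square)
    with minimal[of "x + (- D / (h \<bullet> h)) *\<^sub>R h"] have "D\<^sup>2 / (2 * (h \<bullet> h)) \<le> 0"
      by simp
    moreover have "0 < h \<bullet> h" using False by simp
    ultimately have "D = 0"
      by (simp add: divide_le_0_iff)
    then show ?thesis by (simp add: D_def)
  qed simp
  then show thesis by (rule that)
qed

lemma riesz_map_riesz_inv: "riesz_map (riesz_inv f) = f"
proof (rule f_inv_into_f)
  obtain x where "\<And>h. x \<bullet> h = blinfun_apply f h"
    using riesz_representation[of f] by blast
  then have "riesz_map x = f"
    by (intro blinfun_eqI) simp
  then show "f \<in> range riesz_map" by blast
qed

lemma inner_riesz_inv: "riesz_inv f \<bullet> h = blinfun_apply f h"
  by (metis riesz_map_riesz_inv blinfun_inner_right.rep_eq)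

lemma riesz_inv_eqI: "(\<And>h. x \<bullet> h = blinfun_apply f h) \<Longrightarrow> riesz_inv f = x"
  by (metis inner_riesz_inv vector_eq_rdot)

lemma norm_riesz_inv: "norm (riesz_inv f) = norm f"
proof (rule antisym)
  have "(norm (riesz_inv f))\<^sup>2 \<le> norm f * norm (riesz_inv f)"
    using norm_blinfun[of f "riesz_inv f"]
    by (simp add: power2_norm_eq_inner inner_riesz_inv)
  then show "norm (riesz_inv f) \<le> norm f"
    by (cases "riesz_inv f = 0") (simp_all add: power2_eq_square)
  show "norm f \<le> norm (riesz_inv f)"
  proof (rule norm_blinfun_bound)
    show "norm (blinfun_apply f h) \<le> norm (riesz_inv f) * norm h" for h
      using Cauchy_Schwarz_ineq2[of "riesz_inv f" h] by (simp add: inner_riesz_inv)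
  qed simp
qed

section \<open>Scalar relaxation\<close>

lemma relaxation_iterate:
  fixes x :: "nat \<Rightarrow> 'a::real_vector"
  assumes "\<And>j. j < n \<Longrightarrow> x (Suc j) - c = \<rho> *\<^sub>R (x j - c)"
  shows "x n - c = \<rho> ^ n *\<^sub>R (x 0 - c)"
  using assms by (induction n) simp_all

text \<open>Once the forcing stays below \<open>\<epsilon>\<close>, unrolling the recursion bounds \<open>\<parallel>x k\<parallel>\<close> by the decaying
  initial value plus the geometric sum \<open>\<epsilon> / (1 - q)\<close>.\<close>

lemma forced_contraction_tendsto_0:
  fixes x g :: "nat \<Rightarrow> 'a::real_normed_vector"
  assumes q: "0 \<le> q" "q < 1"
    and rec: "\<And>k. x (Suc k) = q *\<^sub>R x k + g k"
    and g: "g \<longlonglongrightarrow> 0"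
  shows "x \<longlonglongrightarrow> 0"
proof (rule LIMSEQ_I)
  fix e :: real assume e: "0 < e"
  define \<epsilon> where "\<epsilon> = (1 - q) * (e / 2)"
  have "0 < \<epsilon>" using e q by (simp add: \<epsilon>_def)
  with g obtain N where N: "\<And>k. k \<ge> N \<Longrightarrow> norm (g k) < \<epsilon>"
    unfolding LIMSEQ_iff by auto
  have bound: "norm (x (N + k)) \<le> q ^ k * norm (x N) + e / 2" for k
  proof (induction k)
    case 0
    show ?case using e by simp
  next
    case (Suc k)
    have "norm (x (N + Suc k)) \<le> q * norm (x (N + k)) + norm (g (N + k))"
      using rec[of "N + k"] q norm_triangle_ineq[of "q *\<^sub>R x (N + k)" "g (N + k)"] by simp
    also have "\<dots> \<le> q * (q ^ k * norm (x N) + e / 2) + \<epsilon>"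
      using Suc.IH N[of "N + k"] q by (intro add_mono mult_left_mono) auto
    also have "\<dots> = q ^ Suc k * norm (x N) + e / 2"
      by (simp add: \<epsilon>_def field_simps)
    finally show ?case .
  qed
  have "(\<lambda>k. q ^ k * norm (x N)) \<longlonglongrightarrow> 0"
    using q by (intro tendsto_mult_left_zero LIMSEQ_realpow_zero)
  then obtain K where K: "\<And>k. k \<ge> K \<Longrightarrow> \<bar>q ^ k * norm (x N)\<bar> < e / 2"
    using e unfolding LIMSEQ_iff by (metis diff_zero half_gt_zero real_norm_def)
  have "norm (x k - 0) < e" if k: "k \<ge> N + K" for k
  proof -
    have "\<bar>q ^ (k - N) * norm (x N)\<bar> < e / 2" using k by (intro K) simp
    moreover have "norm (x k) \<le> q ^ (k - N) * norm (x N) + e / 2"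
      using bound[of "k - N"] k by simp
    ultimately show ?thesis by simp
  qed
  then show "\<exists>no. \<forall>k\<ge>no. norm (x k - 0) < e" by blast
qed

section \<open>The heavy-ball recursion\<close>

text \<open>Split as \<open>(1 + q)/2 (y\<^sub>k\<^sub>+\<^sub>2 - 2 y\<^sub>k\<^sub>+\<^sub>1 + y\<^sub>k) + (1 - q)/2 (y\<^sub>k\<^sub>+\<^sub>2 - y\<^sub>k) + A y\<^sub>k\<^sub>+\<^sub>1 = 0\<close>,
  the recursion is a discretised oscillator with damping \<open>(1 - q)/2\<close>. Testing it with
  \<open>y\<^sub>k\<^sub>+\<^sub>2 - y\<^sub>k\<close> shows that the energy \<open>E\<close> below loses \<open>(1 - q)/2 \<parallel>y\<^sub>k\<^sub>+\<^sub>2 - y\<^sub>k\<parallel>\<^sup>2\<close> per step. By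
  polarisation of its potential part and the upper bound on \<open>A\<close>, the energy is nonnegative, so the
  differences \<open>z\<^sub>k = y\<^sub>k\<^sub>+\<^sub>2 - y\<^sub>k\<close> tend to zero. This leaves only the constant mode
  \<open>y\<^sub>k\<^sub>+\<^sub>1 = y\<^sub>k\<close> and the alternating mode \<open>y\<^sub>k\<^sub>+\<^sub>1 = -y\<^sub>k\<close>: up to terms in \<open>z\<close>, the recursion says
  that \<open>A\<close> kills the sum of two neighbours and \<open>2 (1 + q) - A\<close> kills their difference. The
  hypotheses make both operators bounded below.\<close>

lemma heavy_ball_tendsto_0:
  fixes y :: "nat \<Rightarrow> 'a::real_inner" and A :: "'a \<Rightarrow> 'a"
  assumes "linear A"
    and selfadjoint: "\<And>v w. A v \<bullet> w = v \<bullet> A w"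
    and coercive: "0 < \<mu>" "\<And>v. \<mu> * (norm v)\<^sup>2 \<le> A v \<bullet> v"
    and upper: "\<And>v. A v \<bullet> v \<le> \<Lambda> * (norm v)\<^sup>2"
    and stable: "\<Lambda> < 2 * (1 + q)"
    and q: "\<bar>q\<bar> < 1"
    and rec: "\<And>k. y (Suc (Suc k)) = (1 + q) *\<^sub>R y (Suc k) - q *\<^sub>R y k - A (y (Suc k))"
  shows "y \<longlonglongrightarrow> 0"
proof -
  interpret A: linear A by fact
  define c where "c = 1 + q"
  define d where "d k = y (Suc k) - y k" for k
  define z where "z k = y (Suc (Suc k)) - y k" for k
  define E where "E k = c / 2 * (norm (d k))\<^sup>2 + A (y k) \<bullet> y (Suc k)" for k
  have Ay: "A (y (Suc k)) = c *\<^sub>R d k - z k" for k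
    using rec[of k] by (simp add: c_def d_def z_def algebra_simps)
  have dissipation: "E k - E (Suc k) = (1 - q) / 2 * (norm (z k))\<^sup>2" for k
  proof -
    have dS: "d (Suc k) = z k - d k" by (simp add: d_def z_def)
    have "E k - E (Suc k) = c / 2 * ((norm (d k))\<^sup>2 - (norm (d (Suc k)))\<^sup>2) - A (y (Suc k)) \<bullet> z k"
      by (simp add: E_def z_def selfadjoint[of "y k"] inner_commute[of "y k"]
          inner_diff_right algebra_simps)
    also have "\<dots> = (1 - q) / 2 * (norm (z k))\<^sup>2"
      unfolding dS Ay power2_norm_eq_inner
      by (simp add: c_def inner_simps inner_commute[of "d k" "z k"]) (simp add: field_simps)
    finally show ?thesis .
  qed
  have E_nonneg: "0 \<le> E k" for k
  proof -
    let ?s = "y (Suc k) + y k"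
    have "A (y k) \<bullet> y (Suc k) = (A ?s \<bullet> ?s - A (d k) \<bullet> d k) / 4"
      by (simp add: d_def A.add A.diff inner_simps selfadjoint[of "y (Suc k)" "y k"]
          inner_commute[of "y (Suc k)" "A (y k)"])
    moreover have "0 \<le> A ?s \<bullet> ?s"
      by (rule order_trans[OF _ coercive(2)]) (use coercive(1) in simp)
    moreover have "A (d k) \<bullet> d k \<le> 2 * c * (norm (d k))\<^sup>2"
      using stable by (intro order_trans[OF upper] mult_right_mono) (simp_all add: c_def)
    ultimately show ?thesis by (simp add: E_def)
  qed
  have "decseq E"
  proof (rule decseq_SucI)
    fix k
    have "0 \<le> (1 - q) / 2 * (norm (z k))\<^sup>2" using q by simp
    then show "E (Suc k) \<le> E k" using dissipation[of k] by simp
  qed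
  then obtain L where "E \<longlonglongrightarrow> L"
    using decseq_convergent[of E 0] E_nonneg by blast
  then have "(\<lambda>k. E k - E (Suc k)) \<longlonglongrightarrow> L - L"
    by (intro tendsto_diff LIMSEQ_Suc)
  then have "(\<lambda>k. (1 - q) / 2 * (norm (z k))\<^sup>2) \<longlonglongrightarrow> 0"
    by (simp add: dissipation)
  then have "(\<lambda>k. 2 / (1 - q) * ((1 - q) / 2 * (norm (z k))\<^sup>2)) \<longlonglongrightarrow> 0"
    by (rule tendsto_mult_right_zero)
  moreover have "2 / (1 - q) * ((1 - q) / 2 * (norm (z k))\<^sup>2) = (norm (z k))\<^sup>2" for k
    using q by (simp add: field_simps)
  ultimately have "(\<lambda>k. (norm (z k))\<^sup>2) \<longlonglongrightarrow> 0"
    by (simp only:)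
  then have z: "z \<longlonglongrightarrow> 0"
    by (simp add: tendsto_norm_zero_iff)
  have z': "(\<lambda>k. z (Suc k)) \<longlonglongrightarrow> 0"
    using z by (rule LIMSEQ_Suc)

  have "(\<lambda>k. y (Suc (Suc k)) + y (Suc k)) \<longlonglongrightarrow> 0"
  proof (rule Lim_null_comparison)
    let ?s = "\<lambda>k. y (Suc (Suc k)) + y (Suc k)"
    show "\<forall>\<^sub>F k in sequentially. norm (?s k) \<le> norm (q *\<^sub>R z k - z (Suc k)) / \<mu>"
    proof (intro always_eventually allI)
      fix k
      have "A (?s k) = q *\<^sub>R z k - z (Suc k)"
        by (simp add: A.add Ay) (simp add: c_def d_def z_def algebra_simps)
      then have "\<mu> * (norm (?s k))\<^sup>2 \<le> norm (q *\<^sub>R z k - z (Suc k)) * norm (?s k)"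
        using coercive(2)[of "?s k"] norm_cauchy_schwarz[of "A (?s k)" "?s k"] by simp
      then show "norm (?s k) \<le> norm (q *\<^sub>R z k - z (Suc k)) / \<mu>"
        using coercive(1) by (cases "?s k = 0") (simp_all add: power2_eq_square field_simps)
    qed
    show "(\<lambda>k. norm (q *\<^sub>R z k - z (Suc k)) / \<mu>) \<longlonglongrightarrow> 0"
      using z z' coercive(1) by (auto intro!: tendsto_eq_intros)
  qed
  moreover have "(\<lambda>k. d (Suc k)) \<longlonglongrightarrow> 0"
  proof (rule Lim_null_comparison)
    let ?\<delta> = "2 * c - \<Lambda>"
    have \<delta>: "0 < ?\<delta>" using stable by (simp add: c_def)
    show "\<forall>\<^sub>F k in sequentially. norm (d (Suc k)) \<le> norm (z (Suc k) + q *\<^sub>R z k) / ?\<delta>"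
    proof (intro always_eventually allI)
      fix k
      let ?d = "d (Suc k)"
      have dk: "d k = z k - ?d" by (simp add: d_def z_def)
      have "A ?d = A (y (Suc (Suc k))) - A (y (Suc k))"
        by (simp add: d_def A.diff)
      also have "\<dots> = (2 * c) *\<^sub>R ?d - (z (Suc k) + q *\<^sub>R z k)"
        unfolding Ay dk by (simp add: c_def algebra_simps flip: scaleR_2)
      finally have "z (Suc k) + q *\<^sub>R z k = (2 * c) *\<^sub>R ?d - A ?d" by simp
      then have "(z (Suc k) + q *\<^sub>R z k) \<bullet> ?d = 2 * c * (norm ?d)\<^sup>2 - A ?d \<bullet> ?d"
        by (simp add: inner_diff_left power2_norm_eq_inner)
      then have "?\<delta> * (norm ?d)\<^sup>2 \<le> norm (z (Suc k) + q *\<^sub>R z k) * norm ?d"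
        using upper[of ?d] norm_cauchy_schwarz[of "z (Suc k) + q *\<^sub>R z k" ?d]
        by (simp add: left_diff_distrib)
      then show "norm ?d \<le> norm (z (Suc k) + q *\<^sub>R z k) / ?\<delta>"
        using \<delta> by (cases "?d = 0") (simp_all add: power2_eq_square pos_le_divide_eq mult.commute)
    qed
    show "(\<lambda>k. norm (z (Suc k) + q *\<^sub>R z k) / ?\<delta>) \<longlonglongrightarrow> 0"
      using z z' \<delta> by (auto intro!: tendsto_eq_intros)
  qed
  ultimately have "(\<lambda>k. (1/2) *\<^sub>R ((y (Suc (Suc k)) + y (Suc k)) + d (Suc k))) \<longlonglongrightarrow> (1/2) *\<^sub>R (0 + 0)"
    by (intro tendsto_intros)
  moreover have "(1/2) *\<^sub>R ((y (Suc (Suc k)) + y (Suc k)) + d (Suc k)) = y (Suc (Suc k))" for k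
    by (simp add: d_def flip: scaleR_2)
  ultimately have "(\<lambda>k. y (Suc (Suc k))) \<longlonglongrightarrow> 0"
    by simp
  then show ?thesis
    using LIMSEQ_offset[of y 2 0] by simp
qed

section \<open>Convergence of the inexact Uzawa iteration\<close>

theorem theorem4p4:
  fixes b :: "'u::{real_inner, complete_space} \<Rightarrow> 'v::{real_inner, complete_space} \<Rightarrow> real"
    and B :: "'u \<Rightarrow> ('v \<Rightarrow>\<^sub>L real)"
    and Bstar :: "'v \<Rightarrow> ('u \<Rightarrow>\<^sub>L real)"
    and l :: "'v \<Rightarrow>\<^sub>L real"
    and m\<^sub>B M \<alpha> \<omega> \<tau> :: real
    and n m :: nat
    and r_init rstar :: 'v and u_init ustar :: 'u
    and r :: "nat \<Rightarrow> 'v" and ri :: "nat \<Rightarrow> nat \<Rightarrow> 'v"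
    and u :: "nat \<Rightarrow> 'u" and ui :: "nat \<Rightarrow> nat \<Rightarrow> 'u"
  assumes b_bilinear: "bilinear b"
    and B_def: "\<And>w v. blinfun_apply (B w) v = b w v"
    and Bstar_def: "\<And>v w. blinfun_apply (Bstar v) w = b w v"
    and constants: "0 < m\<^sub>B" "m\<^sub>B \<le> M"
    and B_lower: "\<And>w. m\<^sub>B * norm w \<le> norm (B w)"
    and B_upper: "\<And>w. norm (B w) \<le> M * norm w"
    and steps: "n \<ge> 1" "m \<ge> 1"
    and iteration: "uzawa_ddr_iterates n m \<alpha> \<omega> \<tau> B Bstar l r_init u_init r ri u ui"
    and saddle1: "\<And>v. inner rstar v + b ustar v = blinfun_apply l v"
    and saddle2: "\<And>w. b w rstar = 0"
    and \<alpha>: "0 < \<alpha>" "\<alpha> < 1"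
    and \<omega>: "0 < \<omega>" "\<omega> < 1"
    and \<tau>: "0 < \<tau>" "\<tau> < 2 / M\<^sup>2"
  shows "(\<lambda>k. r k - rstar) \<longlonglongrightarrow> 0 \<and> (\<lambda>k. u k - ustar) \<longlonglongrightarrow> 0"
proof -
  define T where "T w = riesz_inv (B w)" for w
  define Ts where "Ts v = riesz_inv (Bstar v)" for v
  have T_inner: "T w \<bullet> v = b w v" for w v
    by (simp add: T_def inner_riesz_inv B_def)
  have Ts_inner: "Ts v \<bullet> w = b w v" for v w
    by (simp add: Ts_def inner_riesz_inv Bstar_def)
  have lin_T: "linear T"
    by (rule linearI; rule vector_eq_rdot[THEN iffD1])
       (simp_all add: T_inner inner_simps bilinear_ladd[OF b_bilinear] bilinear_lmul[OF b_bilinear])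
  have lin_Ts: "linear Ts"
    by (rule linearI; rule vector_eq_rdot[THEN iffD1])
       (simp_all add: Ts_inner inner_simps bilinear_radd[OF b_bilinear] bilinear_rmul[OF b_bilinear])
  have T_lower: "m\<^sub>B * norm w \<le> norm (T w)" and T_upper: "norm (T w) \<le> M * norm w" for w
    using B_lower[of w] B_upper[of w] by (simp_all add: T_def norm_riesz_inv)
  have Ts_rstar: "Ts rstar = 0"
    using vector_eq_rdot[of "Ts rstar" 0] by (simp add: Ts_inner saddle2)

  define e where "e k = u k - ustar" for k
  define s where "s k = r k - rstar" for k
  define q where "q = (1 - \<alpha>) ^ n"
  define p where "p = (1 / (1 + \<omega>)) ^ m"
  define \<theta> where "\<theta> = (1 - p) * \<tau>"
  have q: "0 \<le> q" "q < 1"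
    using \<alpha> steps by (simp_all add: q_def power_Suc_less_one power_less_one_iff)
  have p: "0 < p" "p < 1"
    using \<omega> steps by (simp_all add: p_def power_less_one_iff)
  have M: "0 < M" using constants by simp
  have \<theta>: "0 < \<theta>" "\<theta> * M\<^sup>2 < 2"
  proof -
    show "0 < \<theta>" using p \<tau> by (simp add: \<theta>_def)
    have "\<theta> \<le> \<tau>" using p \<tau> by (simp add: \<theta>_def mult_left_le_one_le)
    then have "\<theta> * M\<^sup>2 \<le> \<tau> * M\<^sup>2" by (simp add: mult_right_mono)
    also have "\<dots> < 2" using \<tau>(2) M by (simp add: field_simps)
    finally show "\<theta> * M\<^sup>2 < 2" .
  qed

  have it: "ri k 0 = (if k = 0 then r_init else r (k - 1))"
    "j < n \<Longrightarrow> ri k (Suc j) = ri k j - \<alpha> *\<^sub>R (ri k j - riesz_inv (l - B (u k)))"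
    "r k = ri k n" "ui k 0 = u k"
    "j < m \<Longrightarrow> ui k (Suc j) =
       ui k j - \<omega> *\<^sub>R (ui k (Suc j) - u k - \<tau> *\<^sub>R riesz_inv (Bstar (r k)))"
    "u (Suc k) = ui k m" for k j
    using iteration unfolding uzawa_ddr_iterates_def by blast+

  have s_rec: "s (Suc k) = q *\<^sub>R s k - (1 - q) *\<^sub>R T (e (Suc k))" for k
  proof -
    let ?g = "rstar - T (e (Suc k))"
    have target: "riesz_inv (l - B (u (Suc k))) = ?g"
    proof (rule riesz_inv_eqI)
      fix v
      show "?g \<bullet> v = blinfun_apply (l - B (u (Suc k))) v"
        using saddle1[of v]
        by (simp add: inner_diff_left T_inner blinfun.diff_left B_def e_def bilinear_lsub[OF b_bilinear])
    qed
    have "ri (Suc k) n - ?g = (1 - \<alpha>) ^ n *\<^sub>R (ri (Suc k) 0 - ?g)"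
    proof (rule relaxation_iterate)
      show "ri (Suc k) (Suc j) - ?g = (1 - \<alpha>) *\<^sub>R (ri (Suc k) j - ?g)" if "j < n" for j
        unfolding it(2)[OF that, of "Suc k"] target by (simp add: algebra_simps)
    qed
    then have "r (Suc k) - ?g = q *\<^sub>R (r k - ?g)"
      using it(1)[of "Suc k"] it(3)[of "Suc k"] by (simp add: q_def)
    then show ?thesis by (simp add: s_def algebra_simps)
  qed

  have e_rec: "e (Suc k) = e k + \<theta> *\<^sub>R Ts (s k)" for k
  proof -
    let ?c = "u k + \<tau> *\<^sub>R Ts (r k)"
    have "ui k m - ?c = (1 / (1 + \<omega>)) ^ m *\<^sub>R (ui k 0 - ?c)"
    proof (rule relaxation_iterate)
      fix j assume "j < m"
      \<comment> \<open>solve the implicit step for its new iterate\<close>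
      from it(5)[OF this, of k] have "(1 + \<omega>) *\<^sub>R (ui k (Suc j) - ?c) = ui k j - ?c"
        by (simp add: Ts_def algebra_simps)
      then have "(1 / (1 + \<omega>)) *\<^sub>R ((1 + \<omega>) *\<^sub>R (ui k (Suc j) - ?c)) = (1 / (1 + \<omega>)) *\<^sub>R (ui k j - ?c)"
        by simp
      then show "ui k (Suc j) - ?c = (1 / (1 + \<omega>)) *\<^sub>R (ui k j - ?c)"
        using \<omega> by simp
    qed
    then have "u (Suc k) - ?c = p *\<^sub>R (u k - ?c)"
      using it(4)[of k] it(6)[of k] by (simp add: p_def)
    then have "u (Suc k) = u k + \<theta> *\<^sub>R Ts (r k)"
      by (simp add: \<theta>_def algebra_simps)
    moreover have "Ts (s k) = Ts (r k)"
      by (simp add: s_def linear_diff[OF lin_Ts] Ts_rstar)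
    ultimately show ?thesis by (simp add: e_def)
  qed

  define \<kappa> where "\<kappa> = (1 - q) * \<theta>"
  define A where "A w = \<kappa> *\<^sub>R Ts (T w)" for w
  have \<kappa>: "0 < \<kappa>" using q \<theta> by (simp add: \<kappa>_def)
  have A_inner: "A v \<bullet> w = \<kappa> * (T v \<bullet> T w)" for v w
    using T_inner[of w "T v"] by (simp add: A_def Ts_inner inner_commute[of "T v"])
  have e: "e \<longlonglongrightarrow> 0"
  proof (rule heavy_ball_tendsto_0)
    show "linear A"
      unfolding A_def by (intro linear_compose_scale_right linear_compose[OF lin_T lin_Ts, unfolded o_def])
    show "A v \<bullet> w = v \<bullet> A w" for v w
      using A_inner[of v w] A_inner[of w v] inner_commute[of v "A w"] inner_commute[of "T v" "T w"]
      by (simp only:)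
    show "0 < \<kappa> * m\<^sub>B\<^sup>2" using \<kappa> constants by simp
    show "\<kappa> * m\<^sub>B\<^sup>2 * (norm v)\<^sup>2 \<le> A v \<bullet> v" for v
      using power_mono[OF T_lower[of v], of 2] constants \<kappa>
      by (simp add: A_inner power_mult_distrib mult.assoc flip: power2_norm_eq_inner)
    show "A v \<bullet> v \<le> \<kappa> * M\<^sup>2 * (norm v)\<^sup>2" for v
      using power_mono[OF T_upper[of v], of 2] \<kappa>
      by (simp add: A_inner power_mult_distrib mult.assoc flip: power2_norm_eq_inner)
    have "\<kappa> * M\<^sup>2 < (1 - q) * 2"
      unfolding \<kappa>_def mult.assoc using q \<theta> by (intro mult_strict_left_mono) auto
    also have "\<dots> \<le> 2 * (1 + q)" using q by simp
    finally show "\<kappa> * M\<^sup>2 < 2 * (1 + q)" .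
    show "\<bar>q\<bar> < 1" using q by simp
    show "e (Suc (Suc k)) = (1 + q) *\<^sub>R e (Suc k) - q *\<^sub>R e k - A (e (Suc k))" for k
    proof -
      have "\<theta> *\<^sub>R Ts (s (Suc k)) = q *\<^sub>R (\<theta> *\<^sub>R Ts (s k)) - A (e (Suc k))"
        by (simp add: s_rec linear_diff[OF lin_Ts] linear_scale[OF lin_Ts] A_def \<kappa>_def
            scaleR_right_diff_distrib mult.commute)
      moreover have "\<theta> *\<^sub>R Ts (s k) = e (Suc k) - e k"
        by (simp add: e_rec)
      ultimately show ?thesis
        using e_rec[of "Suc k"] by (simp add: algebra_simps)
    qed
  qed

  have "(\<lambda>k. T (e (Suc k))) \<longlonglongrightarrow> 0"
  proof (rule Lim_null_comparison)
    show "\<forall>\<^sub>F k in sequentially. norm (T (e (Suc k))) \<le> M * norm (e (Suc k))"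
      using T_upper by simp
    show "(\<lambda>k. M * norm (e (Suc k))) \<longlonglongrightarrow> 0"
      using LIMSEQ_Suc[OF e] by (intro tendsto_mult_right_zero tendsto_norm_zero)
  qed
  then have "(\<lambda>k. - ((1 - q) *\<^sub>R T (e (Suc k)))) \<longlonglongrightarrow> 0"
    by (auto intro!: tendsto_eq_intros)
  then have "s \<longlonglongrightarrow> 0"
    using q s_rec by (intro forced_contraction_tendsto_0[of q s "\<lambda>k. - ((1 - q) *\<^sub>R T (e (Suc k)))"]) auto
  with e show ?thesis
    by (simp add: e_def[abs_def] s_def[abs_def])
qed

end
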